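(* Let $k$ be a positive integer, let $G$ and $H$ be connected graphs, let $u\in V(G)$, and suppose that $G(u)$ is not a rooted path (that is, it is not the case that $G$ is a path and $u$ is an end vertex of $G$). Suppose ${\rm dim}_k(G(u))=t$. If ${\rm dim}_{\lceil k/t\rceil}(H)<\infty$, then \[{\rm dim}_k(G(u)\sqcap H)= n(H)\cdot {\rm dim}_k(G(u)),\] where $n(H)$ denotes the number of vertices of $H$.
   Context: All graphs are finite, simple and connected; $d_G(u,v)$ is the shortest-path distance in $G$. For a positive integer $k$, a set $S\subseteq V(G)$ is a $k$-metric generator for $G$ if for every pair of distinct vertices $x,y\in V(G)$ there are at least $k$ vertices $s\in S$ with $d_G(s,x)\neq d_G(s,y)$. For $X\subseteq V(G)$, $S$ is a $k$-metric generator for $X$ if every pair of distinct vertices of $X$ is distinguished by at least $k$ vertices of $S$ (if $|X|\le1$, $S=\emptyset$ qualifies). ${\rm dim}_k(G)$ is the minimum cardinality of a $k$-metric generator for $G$, with ${\rm dim}_k(G)=\infty$ if none exists; ${\rm dim}_k(G)<\infty$ means $G$ admits a $k$-metric generator. For $v\in V(G)$ and integer $\ell\ge0$, $N_\ell(v)=\{x\in V(G): d_G(v,x)=\ell\}$. ${\rm dim}_k(G(u))$ is the size of a smallest set $S\subseteq V(G)$ such that for every $\ell\ge1$, every pair of distinct vertices of $N_\ell(u)$ is distinguished by at least $k$ vertices of $S$ ($\infty$ if no such set exists). The hierarchical product $G(u)\sqcap H$ is the graph with vertex set $V(G)\times V(H)$ in which $(g,h)$ and $(g',h')$ are adjacent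 iff either $g=g'=u$ and $hh'\in E(H)$, or $gg'\in E(G)$ and $h=h'$.
   Formalization: The formal theorem additionally assumes that H has at least two vertices; for H = K_1 the claim fails, e.g. G = C_4, k = 1, where dim_1(G(u)) = 1 but the product is C_4, of metric dimension 2. *)

theory Defs
  imports
    "Graph_Theory.Digraph_Component"
    "Graph_Theory.Shortest_Path"
    "Graph_Theory.Pair_Digraph"
    "HOL-Library.Extended_Nat"
begin

text \<open>
  A finite simple graph is a \<open>pair_graph\<close>: finitely many vertices and a symmetric, loop-free
  set of arcs, so that an edge \<open>xy\<close> is the pair of arcs \<open>(x, y)\<close>, \<open>(y, x)\<close>.
\<close>

definition connected_graph :: "'a pair_pre_digraph \<Rightarrow> bool" where
  "connected_graph G \<longleftrightarrow> pair_graph G \<and> connected (with_proj G)"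

definition gdist :: "'a pair_pre_digraph \<Rightarrow> 'a \<Rightarrow> 'a \<Rightarrow> ereal" where
  "gdist G x y = wf_digraph.\<mu> (with_proj G) (\<lambda>_. 1) x y"

definition distinguishers :: "'a pair_pre_digraph \<Rightarrow> 'a set \<Rightarrow> 'a \<Rightarrow> 'a \<Rightarrow> 'a set" where
  "distinguishers G S x y = {s \<in> S. gdist G s x \<noteq> gdist G s y}"

definition metric_generator_for ::
  "nat \<Rightarrow> 'a pair_pre_digraph \<Rightarrow> 'a set \<Rightarrow> 'a set \<Rightarrow> bool" where
  "metric_generator_for k G X S \<longleftrightarrow>
     S \<subseteq> pverts G \<and> (\<forall>x\<in>X. \<forall>y\<in>X. x \<noteq> y \<longrightarrow> k \<le> card (distinguishers G S x y))"

definition metric_generator :: "nat \<Rightarrow> 'a pair_pre_digraph \<Rightarrow> 'a set \<Rightarrow> bool" where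
  "metric_generator k G S \<longleftrightarrow> metric_generator_for k G (pverts G) S"

text \<open>The infimum in \<^typ>\<open>enat\<close> is the minimum, and \<open>\<infinity>\<close> if there is no generator.\<close>

definition metric_dim :: "nat \<Rightarrow> 'a pair_pre_digraph \<Rightarrow> enat" where
  "metric_dim k G = (INF S \<in> {S. metric_generator k G S}. enat (card S))"

definition sphere_of :: "'a pair_pre_digraph \<Rightarrow> nat \<Rightarrow> 'a \<Rightarrow> 'a set" where
  "sphere_of G l v = {x \<in> pverts G. gdist G v x = ereal (real l)}"

definition rooted_metric_generator ::
  "nat \<Rightarrow> 'a pair_pre_digraph \<Rightarrow> 'a \<Rightarrow> 'a set \<Rightarrow> bool" where
  "rooted_metric_generator k G u S \<longleftrightarrow>
     S \<subseteq> pverts G \<and> (\<forall>l\<ge>1. metric_generator_for k G (sphere_of G l u) S)"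

definition rooted_metric_dim :: "nat \<Rightarrow> 'a pair_pre_digraph \<Rightarrow> 'a \<Rightarrow> enat" where
  "rooted_metric_dim k G u = (INF S \<in> {S. rooted_metric_generator k G u S}. enat (card S))"

text \<open>
  The list \<open>vs\<close> enumerates the vertices along the path. The one-vertex graph is a path, and its
  vertex is an end vertex.
\<close>

definition rooted_path :: "'a pair_pre_digraph \<Rightarrow> 'a \<Rightarrow> bool" where
  "rooted_path G u \<longleftrightarrow>
     (\<exists>vs. vs \<noteq> [] \<and> distinct vs \<and> pverts G = set vs \<and>
        parcs G = {(vs ! i, vs ! j) | i j.
                     i < length vs \<and> j < length vs \<and> (j = Suc i \<or> i = Suc j)} \<and>
        (u = hd vs \<or> u = last vs))"

text \<open>
  The product for a one-vertex \<open>H\<close> is a copy of \<open>G\<close>, and \<open>metric_dim k G\<close> may exceed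
  \<open>rooted_metric_dim k G u\<close> (for the 4-cycle and \<open>k = 1\<close> they are 2 and 1).
\<close>

definition hierarchical_product ::
  "'a pair_pre_digraph \<Rightarrow> 'a \<Rightarrow> 'b pair_pre_digraph \<Rightarrow> ('a \<times> 'b) pair_pre_digraph" where
  "hierarchical_product G u H =
     \<lparr> pverts = pverts G \<times> pverts H,
       parcs = {((g, h), (g', h')) | g h g' h'.
                  g \<in> pverts G \<and> g' \<in> pverts G \<and> h \<in> pverts H \<and> h' \<in> pverts H \<and>
                  (g = u \<and> g' = u \<and> (h, h') \<in> parcs H \<or> (g, g') \<in> parcs G \<and> h = h')} \<rparr>"

text \<open>\<open>\<lceil>k / t\<rceil>\<close>, with \<open>k / \<infinity> = 0\<close>.\<close>

fun ceil_div :: "nat \<Rightarrow> enat \<Rightarrow> nat" where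
  "ceil_div k (enat t) = nat \<lceil>real k / real t\<rceil>"
| "ceil_div k \<infinity> = 0"

end

(*
  A copy of G in the product meets the rest of the product only at u, so a vertex in another copy
  cannot separate two vertices of the same copy that are equidistant from u. Hence a generator of
  the product restricts to a rooted generator on each copy, which gives the lower bound.
  Conversely let W be a minimum rooted generator and take W in every copy. Since G is not a path
  rooted at u, some two vertices are equidistant from u, and so W has at least k elements. Two
  vertices that the rooted condition does not cover are separated by a whole copy of W: another
  copy if they lie in the same copy, and the copy of the one closer to u if they do not.
*)
theory Submission
  imports Defs
begin

section \<open>Hop distance\<close>

text \<open>A certificate for distances from \<open>x\<close>: growth by at most one along arcs
  bounds every walk from below, and descending through predecessors builds a walk that attains the
  bound. An explicit formula for distances in the product can thus be checked arc by arc, and the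
  walks come from \<open>pred\<close> rather than from a separate proof of connectivity.\<close>

lemma gdist_eqI:
  fixes f :: "'a \<Rightarrow> nat"
  assumes wf: "pair_wf_digraph G" and x: "x \<in> pverts G" and fx: "f x = 0"
    and arc: "\<And>a b. (a, b) \<in> parcs G \<Longrightarrow> f b \<le> Suc (f a)"
    and pred: "\<And>v. v \<in> pverts G \<Longrightarrow> v \<noteq> x \<Longrightarrow> \<exists>w. (w, v) \<in> parcs G \<and> f v = Suc (f w)"
    and y: "y \<in> pverts G"
  shows "gdist G x y = ereal (real (f y))"
proof -
  interpret pair_wf_digraph G by (fact wf)
  have lower: "f b \<le> f a + length p" if "awalk a p b" for a p b
    using that
  proof (induction p arbitrary: a)
    case Nil
    then show ?case by (simp add: awalk_Nil_iff)
  next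
    case (Cons e p)
    obtain c where "e = (a, c)" "(a, c) \<in> parcs G" "awalk c p b"
      using Cons.prems by (cases e) (auto simp: awalk_Cons_iff)
    then show ?case
      using Cons.IH[of c] arc[of a c] by simp
  qed
  have upper: "\<exists>p. awalk x p b \<and> length p = n" if "b \<in> pverts G" "f b = n" for b n
    using that
  proof (induction n arbitrary: b)
    case 0
    then have "b = x" using pred[of b] by force
    then show ?case using x by (intro exI[of _ "[]"]) (simp add: awalk_Nil_iff)
  next
    case (Suc n)
    then have "b \<noteq> x" using fx by auto
    with pred[of b] Suc.prems obtain w where w: "(w, b) \<in> parcs G" "f w = n" by auto
    with Suc.IH[of w] obtain p where "awalk x p w" "length p = n"
      using in_arcsD1 by blast
    moreover have "awalk w [(w, b)] b"
      using w(1) Suc.prems by (auto simp: awalk_Cons_iff awalk_Nil_iff in_arcsD1)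
    ultimately show ?case
      by (intro exI[of _ "p @ [(w, b)]"]) auto
  qed
  have cost: "awalk_cost (\<lambda>_. 1) p = real (length p)" for p
    by (simp add: awalk_cost_def sum_list_triv)
  show ?thesis
    unfolding gdist_def \<mu>_def
  proof (rule antisym)
    obtain p where "awalk x p y" "length p = f y" using upper y by blast
    then show "(INF p\<in>{p. awalk x p y}. ereal (awalk_cost (\<lambda>_. 1) p)) \<le> ereal (real (f y))"
      by (intro INF_lower2[of p]) (auto simp: cost)
  next
    show "ereal (real (f y)) \<le> (INF p\<in>{p. awalk x p y}. ereal (awalk_cost (\<lambda>_. 1) p))"
      using lower[of x _ y] fx by (intro INF_greatest) (auto simp: cost)
  qed
qed

text \<open>A natural-number version of \<open>gdist\<close>, so that inequalities and successors
  can be handled by arithmetic. For an unreachable pair the \<open>LEAST\<close> is unspecified; the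
  two notions are identified for vertices of a connected graph in
  \<open>gdist_eq_hops\<close>.\<close>

definition hops :: "'a pair_pre_digraph \<Rightarrow> 'a \<Rightarrow> 'a \<Rightarrow> nat" where
  "hops G x y = (LEAST n. (x, y) \<in> parcs G ^^ n)"

lemma connected_graph_wf: "connected_graph G \<Longrightarrow> pair_wf_digraph G"
  unfolding connected_graph_def pair_graph_def pair_digraph_def pair_fin_digraph_def by blast

lemma connected_graph_finite: "connected_graph G \<Longrightarrow> finite (pverts G)"
  unfolding connected_graph_def
  by (meson pair_fin_digraph.pair_finite_verts pair_digraph_def pair_graph_def)

lemma connected_graph_parcs_verts:
  assumes "connected_graph G" "(x, y) \<in> parcs G"
  shows "x \<in> pverts G" "y \<in> pverts G"
  using pair_wf_digraph.wellformed'[OF connected_graph_wf[OF assms(1)] assms(2)] by auto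

lemma connected_graph_parcs_sym:
  assumes "connected_graph G" "(x, y) \<in> parcs G"
  shows "(y, x) \<in> parcs G"
proof -
  interpret pair_graph G using assms(1) by (simp add: connected_graph_def)
  show ?thesis using assms(2) arcs_symmetric by blast
qed

lemma connected_graph_parcs_neq:
  assumes "connected_graph G" "(x, y) \<in> parcs G"
  shows "x \<noteq> y"
proof -
  interpret pair_graph G using assms(1) by (simp add: connected_graph_def)
  show ?thesis using assms(2) no_loops' by blast
qed

lemma hops_refl [simp]: "hops G x x = 0"
  by (simp add: hops_def)

lemma hops_le: "(x, y) \<in> parcs G ^^ n \<Longrightarrow> hops G x y \<le> n"
  by (simp add: hops_def Least_le)

context
  fixes G :: "'a pair_pre_digraph"
  assumes G: "connected_graph G"
begin

text \<open>Since the arc set is symmetric, connectivity gives directed reachability, so some power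
  of the arc relation contains the pair and the \<open>LEAST\<close> is attained.\<close>

lemma relpow_hops:
  assumes "x \<in> pverts G" "y \<in> pverts G"
  shows "(x, y) \<in> parcs G ^^ hops G x y"
proof -
  interpret pair_graph G using G by (simp add: connected_graph_def)
  have "strongly_connected (with_proj G)"
    using G symmetric_connected_imp_strongly_connected[OF pair_sym_arcs]
    by (simp add: connected_graph_def)
  then have "x \<rightarrow>\<^sup>*\<^bsub>with_proj G\<^esub> y"
    using assms by (auto simp: strongly_connected_def)
  then have "(x, y) \<in> (parcs G)\<^sup>*"
    using reachable_rtranclI by fastforce
  then show ?thesis
    unfolding hops_def by (metis LeastI rtrancl_power)
qed

lemma hops_triangle:
  assumes "x \<in> pverts G" "y \<in> pverts G" "z \<in> pverts G"
  shows "hops G x z \<le> hops G x y + hops G y z"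
  using relpow_hops[OF assms(1,2)] relpow_hops[OF assms(2,3)]
  by (intro hops_le) (auto simp: relpow_add)

lemma hops_arc:
  assumes "x \<in> pverts G" "(a, b) \<in> parcs G"
  shows "hops G x b \<le> Suc (hops G x a)"
  using relpow_hops[OF assms(1) connected_graph_parcs_verts(1)[OF G assms(2)]] assms(2)
  by (intro hops_le) auto

text \<open>The last arc of a shortest walk starts at a suitable \<open>w\<close>: it is reached in
  one step fewer, and by \<open>hops_arc\<close> no sooner.\<close>

lemma hops_pred:
  assumes "x \<in> pverts G" "y \<in> pverts G" "y \<noteq> x"
  shows "\<exists>w. (w, y) \<in> parcs G \<and> hops G x y = Suc (hops G x w)"
proof -
  have y: "(x, y) \<in> parcs G ^^ hops G x y" using relpow_hops assms by blast
  with assms(3) obtain n where n: "hops G x y = Suc n" by (cases "hops G x y") auto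
  with y obtain w where w: "(x, w) \<in> parcs G ^^ n" "(w, y) \<in> parcs G" by auto
  with hops_le[OF w(1)] hops_arc[OF assms(1) w(2)] n show ?thesis by auto
qed

lemma hops_eq_0_iff:
  assumes "x \<in> pverts G" "y \<in> pverts G"
  shows "hops G x y = 0 \<longleftrightarrow> x = y"
  using hops_pred[OF assms] by (metis hops_refl nat.distinct(1))

lemma gdist_eq_hops:
  assumes "x \<in> pverts G" "y \<in> pverts G"
  shows "gdist G x y = ereal (real (hops G x y))"
  by (rule gdist_eqI)
    (use assms in \<open>auto simp: connected_graph_wf[OF G] intro: hops_arc hops_pred\<close>)

section \<open>Spheres around the root and rooted paths\<close>

lemma sphere_of_eq:
  assumes "u \<in> pverts G"
  shows "sphere_of G l u = {x \<in> pverts G. hops G u x = l}"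
  using gdist_eq_hops[OF assms] by (auto simp: sphere_of_def)

lemma distinguishers_eq:
  assumes "S \<subseteq> pverts G" "x \<in> pverts G" "y \<in> pverts G"
  shows "distinguishers G S x y = {s \<in> S. hops G s x \<noteq> hops G s y}"
  using assms gdist_eq_hops by (auto simp: distinguishers_def subset_iff)

text \<open>If no sphere of positive radius has two vertices, distance from \<open>u\<close> is a
  bijection onto an initial segment of the naturals, and arcs join exactly the consecutive
  values.\<close>

lemma rooted_pathI:
  assumes u: "u \<in> pverts G"
    and sph: "\<And>l x y. l \<ge> 1 \<Longrightarrow> x \<in> sphere_of G l u \<Longrightarrow> y \<in> sphere_of G l u \<Longrightarrow> x = y"
  shows "rooted_path G u"
proof -
  define d where "d = hops G u"
  have inj: "inj_on d (pverts G)"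
  proof (rule inj_onI)
    fix x y assume xy: "x \<in> pverts G" "y \<in> pverts G" "d x = d y"
    show "x = y"
    proof (cases "d x = 0")
      case True
      then show ?thesis using xy hops_eq_0_iff[OF u] by (auto simp: d_def)
    next
      case False
      then show ?thesis using xy sph[of "d x" x y] by (auto simp: sphere_of_eq[OF u] d_def)
    qed
  qed
  define N where "N = Max (d ` pverts G)"
  have fin: "finite (d ` pverts G)" using connected_graph_finite[OF G] by simp
  have down: "n \<in> d ` pverts G" if "Suc n \<in> d ` pverts G" for n
  proof -
    from that obtain y where y: "y \<in> pverts G" "d y = Suc n" by force
    then have "y \<noteq> u" by (auto simp: d_def)
    with hops_pred[OF u y(1)] y obtain w where "(w, y) \<in> parcs G" "d w = n" by (auto simp: d_def)
    then show ?thesis using connected_graph_parcs_verts[OF G] by blast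
  qed
  have N: "N \<in> d ` pverts G" unfolding N_def using fin u by (intro Max_in) auto
  have "n \<in> d ` pverts G" if "n \<le> N" for n
    using that N by (induction rule: inc_induct) (auto intro: down)
  then have img: "d ` pverts G = {..N}"
    using fin by (auto simp: N_def)
  \<comment> \<open>The inverse of \<open>d\<close> lists the vertices by distance from
    \<open>u\<close>, so \<open>u\<close> comes first.\<close>
  define vs where "vs = map (inv_into (pverts G) d) [0..<Suc N]"
  have len: "length vs = Suc N" by (simp add: vs_def)
  have nth: "vs ! i = inv_into (pverts G) d i" if "i \<le> N" for i
    using that by (simp add: vs_def del: upt_Suc)
  have vs_mem: "vs ! i \<in> pverts G" "d (vs ! i) = i" if "i \<le> N" for i
    using that img by (auto simp: nth inv_into_into f_inv_into_f)
  have nth_d: "d v \<le> N" "vs ! d v = v" if "v \<in> pverts G" for v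
  proof -
    show "d v \<le> N" using that img by auto
    then show "vs ! d v = v" using that inj by (simp add: nth)
  qed
  have set: "pverts G = set vs"
  proof (rule subset_antisym; rule subsetI)
    fix v assume "v \<in> pverts G"
    then show "v \<in> set vs" using nth_d[of v] len by (metis nth_mem le_imp_less_Suc)
  next
    fix v assume "v \<in> set vs"
    then show "v \<in> pverts G" using vs_mem(1) len by (metis in_set_conv_nth less_Suc_eq_le)
  qed
  have dist: "distinct vs"
    unfolding distinct_conv_nth len using vs_mem(2) by (metis less_Suc_eq_le)
  \<comment> \<open>The vertex at distance \<open>Suc i\<close> has a neighbour at distance
    \<open>i\<close>, and \<open>vs ! i\<close> is the only vertex there.\<close>
  have step: "(vs ! i, vs ! Suc i) \<in> parcs G" if "Suc i \<le> N" for i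
  proof -
    have "vs ! Suc i \<noteq> u" using vs_mem(2)[OF that] by (auto simp: d_def)
    with hops_pred[OF u vs_mem(1)[OF that]] vs_mem(2)[OF that]
    obtain w where w: "(w, vs ! Suc i) \<in> parcs G" "d w = i" by (auto simp: d_def)
    moreover have "w = vs ! i"
      using nth_d(2)[OF connected_graph_parcs_verts(1)[OF G w(1)]] w(2) by simp
    ultimately show ?thesis by simp
  qed
  \<comment> \<open>Along an arc and its reverse the distance grows by at most one; equal values
    would make the arc a loop, by injectivity.\<close>
  have close: "d b = Suc (d a) \<or> d a = Suc (d b)" if ab: "(a, b) \<in> parcs G" for a b
  proof -
    note ba = connected_graph_parcs_sym[OF G ab]
    have "d a \<noteq> d b"
      using inj connected_graph_parcs_verts[OF G ab] connected_graph_parcs_neq[OF G ab]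
      by (auto dest: inj_onD)
    then show ?thesis using hops_arc[OF u ab] hops_arc[OF u ba] by (auto simp: d_def)
  qed
  have arcs: "parcs G = {(vs ! i, vs ! j) | i j.
      i < length vs \<and> j < length vs \<and> (j = Suc i \<or> i = Suc j)}" (is "_ = ?R")
  proof (rule subset_antisym; rule subrelI)
    fix a b assume ab: "(a, b) \<in> parcs G"
    note v = connected_graph_parcs_verts[OF G ab]
    show "(a, b) \<in> ?R"
      using nth_d[OF v(1)] nth_d[OF v(2)] close[OF ab]
      by (intro CollectI exI[of _ "d a"] exI[of _ "d b"]) (simp add: len)
  next
    fix a b assume "(a, b) \<in> ?R"
    then show "(a, b) \<in> parcs G"
      using step connected_graph_parcs_sym[OF G] by (auto simp: len)
  qed
  have "vs ! 0 = u" using nth_d(2)[OF u] by (simp add: d_def)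
  moreover have "vs \<noteq> []" using len by auto
  ultimately show ?thesis
    unfolding rooted_path_def
    by (intro exI[of _ vs]) (use set dist arcs in \<open>auto simp: hd_conv_nth\<close>)
qed

text \<open>By \<open>rooted_pathI\<close> some sphere of positive radius has two vertices, and
  their \<open>k\<close> distinguishers all lie in \<open>W\<close>. On a rooted path the empty set
  would be a rooted generator, and the bound would fail for positive \<open>k\<close>.\<close>

lemma rooted_metric_generator_card_ge:
  assumes u: "u \<in> pverts G" and np: "\<not> rooted_path G u" and W: "rooted_metric_generator k G u W"
  shows "k \<le> card W"
proof -
  obtain l x y where "l \<ge> 1" "x \<in> sphere_of G l u" "y \<in> sphere_of G l u" "x \<noteq> y"
    using rooted_pathI[OF u] np by blast
  with W have "k \<le> card (distinguishers G W x y)"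
    by (auto simp: rooted_metric_generator_def metric_generator_for_def)
  also have "finite W"
    using W connected_graph_finite[OF G]
    by (auto simp: rooted_metric_generator_def intro: finite_subset)
  then have "card (distinguishers G W x y) \<le> card W"
    by (intro card_mono) (auto simp: distinguishers_def)
  finally show ?thesis .
qed

end

section \<open>The hierarchical product\<close>

context
  fixes G :: "'a pair_pre_digraph" and H :: "'b pair_pre_digraph" and u :: 'a
  assumes G: "connected_graph G" and H: "connected_graph H" and u: "u \<in> pverts G"
begin

section \<open>Distances in the product\<close>

lemma pverts_hierarchical_product:
  "pverts (hierarchical_product G u H) = pverts G \<times> pverts H"
  by (simp add: hierarchical_product_def)

lemma parcs_hierarchical_product_iff:
  "((g, h), (g', h')) \<in> parcs (hierarchical_product G u H) \<longleftrightarrow>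
     g = u \<and> g' = u \<and> (h, h') \<in> parcs H \<or> (g, g') \<in> parcs G \<and> h = h' \<and> h \<in> pverts H"
  using u connected_graph_parcs_verts[OF G] connected_graph_parcs_verts[OF H]
  by (auto simp: hierarchical_product_def)

text \<open>A copy of \<open>G\<close> is entered and left only through its root. A walk between
  different copies therefore passes both roots, while leaving a copy and returning gives no shortcut
  within it.\<close>

lemma gdist_hierarchical_product:
  assumes g: "g \<in> pverts G" "h \<in> pverts H" and g': "g' \<in> pverts G" "h' \<in> pverts H"
  shows "gdist (hierarchical_product G u H) (g, h) (g', h') =
    ereal (real (if h = h' then hops G g g' else hops G g u + hops H h h' + hops G u g'))"
proof -
  define f where "f = (\<lambda>(a, b). if h = b then hops G g a else hops G g u + hops H h b + hops G u a)"
  \<comment> \<open>At roots both branches of \<open>f\<close> agree, since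
    \<open>hops H h h = 0\<close>; arcs along \<open>H\<close> then need no case split on whether
    they touch the copy at \<open>h\<close>.\<close>
  have fu: "f (u, b) = hops G g u + hops H h b" for b
    by (simp add: f_def)
  have "gdist (hierarchical_product G u H) (g, h) (g', h') = ereal (real (f (g', h')))"
  proof (rule gdist_eqI)
    show "pair_wf_digraph (hierarchical_product G u H)"
      by unfold_locales (auto simp: hierarchical_product_def)
    show "(g, h) \<in> pverts (hierarchical_product G u H)" "(g', h') \<in> pverts (hierarchical_product G u H)"
      using g g' by (auto simp: pverts_hierarchical_product)
    show "f (g, h) = 0" by (simp add: f_def)
    show "f q \<le> Suc (f p)" if "(p, q) \<in> parcs (hierarchical_product G u H)" for p q
    proof -
      obtain a b a' b' where pq: "p = (a, b)" "q = (a', b')" by (metis surj_pair)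
      from that[unfolded pq parcs_hierarchical_product_iff] show ?thesis
      proof (elim disjE conjE)
        assume "a = u" "a' = u" "(b, b') \<in> parcs H"
        then show ?thesis using hops_arc[OF H g(2)] by (simp add: pq fu)
      next
        assume "(a, a') \<in> parcs G" "b = b'"
        then show ?thesis
          using hops_arc[OF G g(1)] hops_arc[OF G u] by (simp add: pq f_def)
      qed
    qed
    show "\<exists>p. (p, q) \<in> parcs (hierarchical_product G u H) \<and> f q = Suc (f p)"
      if q: "q \<in> pverts (hierarchical_product G u H)" "q \<noteq> (g, h)" for q
    proof -
      obtain a b where ab: "q = (a, b)" "a \<in> pverts G" "b \<in> pverts H"
        using q(1) by (auto simp: pverts_hierarchical_product)
      \<comment> \<open>The predecessor is taken towards \<open>g\<close> in the starting copy,
        towards the root in any other copy, and along \<open>H\<close> once at such a root.\<close>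
      consider "b = h" "a \<noteq> g" | "b \<noteq> h" "a \<noteq> u" | "b \<noteq> h" "a = u"
        using q(2) ab(1) by auto
      then show ?thesis
      proof cases
        case 1
        from hops_pred[OF G g(1) ab(2) 1(2)]
        obtain w where "(w, a) \<in> parcs G" "hops G g a = Suc (hops G g w)" by blast
        then show ?thesis using 1 ab
          by (intro exI[of _ "(w, b)"]) (simp add: parcs_hierarchical_product_iff f_def)
      next
        case 2
        from hops_pred[OF G u ab(2) 2(2)]
        obtain w where "(w, a) \<in> parcs G" "hops G u a = Suc (hops G u w)" by blast
        then show ?thesis using 2 ab
          by (intro exI[of _ "(w, b)"]) (simp add: parcs_hierarchical_product_iff f_def)
      next
        case 3
        from hops_pred[OF H g(2) ab(3) 3(1)]
        obtain w where "(w, b) \<in> parcs H" "hops H h b = Suc (hops H h w)" by blast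
        then show ?thesis using 3 ab
          by (intro exI[of _ "(u, w)"]) (simp add: parcs_hierarchical_product_iff fu)
      qed
    qed
  qed
  then show ?thesis by (simp add: f_def)
qed

section \<open>Lower bound: generators of the product restricted to the copies of
  \<open>G\<close>\<close>

lemma rooted_metric_generator_fibre:
  assumes S: "metric_generator k (hierarchical_product G u H) S" and h: "h \<in> pverts H"
  shows "rooted_metric_generator k G u {g. (g, h) \<in> S}" (is "rooted_metric_generator k G u ?F")
  unfolding rooted_metric_generator_def metric_generator_for_def
proof (intro conjI allI ballI impI)
  have SV: "S \<subseteq> pverts G \<times> pverts H"
    using S by (simp add: metric_generator_def metric_generator_for_def pverts_hierarchical_product)
  then show F: "?F \<subseteq> pverts G" by auto
  then show "?F \<subseteq> pverts G" .
  fix l x y assume "l \<ge> 1" "x \<in> sphere_of G l u" "y \<in> sphere_of G l u" and ne: "x \<noteq> y"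
  then have xy: "x \<in> pverts G" "y \<in> pverts G" "hops G u x = hops G u y"
    by (auto simp: sphere_of_eq[OF G u])
  \<comment> \<open>From another copy, the two distances differ only in the summands
    \<open>hops G u x\<close> and \<open>hops G u y\<close>, which are equal here. Hence only
    elements of \<open>S\<close> in copy \<open>h\<close> can distinguish the pair, and they do so
    by distances in \<open>G\<close>.\<close>
  have "distinguishers (hierarchical_product G u H) S (x, h) (y, h)
      \<subseteq> (\<lambda>g. (g, h)) ` distinguishers G ?F x y"
    using SV h xy
    by (auto simp: gdist_eq_hops[OF G] distinguishers_def gdist_hierarchical_product
        subset_iff image_iff split: if_splits)
  then have "card (distinguishers (hierarchical_product G u H) S (x, h) (y, h))
      \<le> card (distinguishers G ?F x y)"
    using finite_subset[OF F connected_graph_finite[OF G]]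
    by (intro surj_card_le) (auto simp: distinguishers_def)
  moreover have "k \<le> card (distinguishers (hierarchical_product G u H) S (x, h) (y, h))"
    using S ne xy h
    by (auto simp: metric_generator_def metric_generator_for_def pverts_hierarchical_product)
  ultimately show "k \<le> card (distinguishers G ?F x y)" by simp
qed

text \<open>The fibres over the vertices of \<open>H\<close> partition \<open>S\<close>, and each is
  a rooted generator, so their sizes can be bounded separately and summed.\<close>

lemma metric_generator_card_ge:
  assumes S: "metric_generator k (hierarchical_product G u H) S"
  shows "enat (card (pverts H)) * rooted_metric_dim k G u \<le> enat (card S)"
proof -
  have SV: "S \<subseteq> pverts G \<times> pverts H"
    using S by (simp add: metric_generator_def metric_generator_for_def pverts_hierarchical_product)
  define F where "F h = {g. (g, h) \<in> S}" for h
  have fin: "finite (F h)" for h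
    using SV by (intro finite_subset[OF _ connected_graph_finite[OF G]]) (auto simp: F_def)
  have "bij_betw prod.swap (SIGMA h:pverts H. F h) S"
    using SV by (intro bij_betwI[of _ _ _ prod.swap]) (auto simp: F_def)
  then have "card S = (\<Sum>h\<in>pverts H. card (F h))"
    using fin connected_graph_finite[OF H] by (simp flip: bij_betw_same_card)
  moreover have "rooted_metric_dim k G u \<le> enat (card (F h))" if "h \<in> pverts H" for h
    using rooted_metric_generator_fibre[OF S that]
    unfolding rooted_metric_dim_def F_def by (intro INF_lower) simp
  then have "of_nat (card (pverts H)) * rooted_metric_dim k G u \<le> (\<Sum>h\<in>pverts H. enat (card (F h)))"
    by (rule sum_bounded_below)
  ultimately show ?thesis
    by (simp only: of_nat_eq_enat[symmetric] of_nat_sum)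
qed

section \<open>Upper bound: a rooted generator repeated in every copy\<close>

lemma metric_generator_Times:
  assumes W: "rooted_metric_generator k G u W" and kW: "k \<le> card W"
    and n: "card (pverts H) \<ge> 2"
  shows "metric_generator k (hierarchical_product G u H) (W \<times> pverts H)"
proof -
  let ?P = "hierarchical_product G u H"
  have WV: "W \<subseteq> pverts G" using W by (simp add: rooted_metric_generator_def)
  have finW: "finite W" using WV connected_graph_finite[OF G] finite_subset by blast
  define D where "D = distinguishers ?P (W \<times> pverts H)"
  have finD: "finite (D p q)" for p q
    unfolding D_def distinguishers_def using finW connected_graph_finite[OF H] by auto
  \<comment> \<open>Each case below needs only one copy \<open>c\<close> and a set \<open>A\<close>
    of at least \<open>k\<close> vertices whose images in that copy all distinguish the
    pair.\<close>
  have card_ge: "k \<le> card (D p q)" if "(\<lambda>w. (w, c)) ` A \<subseteq> D p q" "k \<le> card A" for c A p q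
    using card_mono[OF finD that(1)] that(2) by (simp add: card_image inj_on_def)
  have D_iff: "(w, c) \<in> D (x, h) (y, h') \<longleftrightarrow> w \<in> W \<and>
      (if c = h then hops G w x else hops G w u + hops H c h + hops G u x) \<noteq>
      (if c = h' then hops G w y else hops G w u + hops H c h' + hops G u y)"
    if "x \<in> pverts G" "h \<in> pverts H" "y \<in> pverts G" "h' \<in> pverts H" "c \<in> pverts H" for w c x h y h'
    using that WV by (auto simp: D_def distinguishers_def gdist_hierarchical_product subset_iff
        simp del: of_nat_add split: if_splits)
  have "k \<le> card (D (x, h) (y, h'))"
    if x: "x \<in> pverts G" "h \<in> pverts H" and y: "y \<in> pverts G" "h' \<in> pverts H"
      and ne: "(x, h) \<noteq> (y, h')" for x h y h'
  proof -
    consider (same) "h = h'" "x \<noteq> y" "hops G u x = hops G u y"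
      | (levels) "h = h'" "hops G u x \<noteq> hops G u y"
      | (left) "h \<noteq> h'" "hops G u x \<le> hops G u y"
      | (right) "h \<noteq> h'" "hops G u y \<le> hops G u x"
      using ne by fastforce
    then show ?thesis
    proof cases
      case same
      \<comment> \<open>Rooted generators only treat spheres of radius at least one; at radius zero
        both vertices would be \<open>u\<close>.\<close>
      then have "hops G u x \<noteq> 0" using x y hops_eq_0_iff[OF G u] by metis
      then have "k \<le> card (distinguishers G W x y)"
        using W same x y
        by (auto simp: rooted_metric_generator_def metric_generator_for_def sphere_of_eq[OF G u] Suc_le_eq)
      moreover have "(\<lambda>w. (w, h)) ` distinguishers G W x y \<subseteq> D (x, h) (y, h')"
        using x y same by (auto simp: D_iff distinguishers_eq[OF G WV])
      ultimately show ?thesis using card_ge by blast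
    next
      case levels
      \<comment> \<open>A second copy sees the pair through the root of copy \<open>h\<close>, so
        all of its vertices detect the difference in levels. Its existence rests on
        \<open>n\<close>.\<close>
      have "\<exists>c\<in>pverts H. c \<noteq> h"
      proof (rule ccontr)
        assume "\<not> ?thesis"
        then have "pverts H \<subseteq> {h}" by auto
        from card_mono[OF _ this] n show False by simp
      qed
      then obtain c where "c \<in> pverts H" "c \<noteq> h" by blast
      then have "(\<lambda>w. (w, c)) ` W \<subseteq> D (x, h) (y, h')"
        using x y levels by (auto simp: D_iff)
      then show ?thesis using kW by (rule card_ge)
    next
      case left
      \<comment> \<open>From \<open>(w, h)\<close> the vertex \<open>(x, h)\<close> is strictly
        nearer: its distance is at most \<open>hops G w u + hops G u x\<close>, while that of
        \<open>(y, h')\<close> is at least this plus the positive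
        \<open>hops H h h'\<close>.\<close>
      have "hops H h h' \<noteq> 0" using hops_eq_0_iff[OF H] x y left by blast
      moreover have "hops G w x \<le> hops G w u + hops G u x" if "w \<in> W" for w
        using hops_triangle[OF G] that WV u x by blast
      ultimately have "(\<lambda>w. (w, h)) ` W \<subseteq> D (x, h) (y, h')"
        using x y left by (fastforce simp: D_iff)
      then show ?thesis using kW by (rule card_ge)
    next
      case right
      have "hops H h' h \<noteq> 0" using hops_eq_0_iff[OF H] x y right by blast
      moreover have "hops G w y \<le> hops G w u + hops G u y" if "w \<in> W" for w
        using hops_triangle[OF G] that WV u y by blast
      ultimately have "(\<lambda>w. (w, h')) ` W \<subseteq> D (x, h) (y, h')"
        using x y right by (fastforce simp: D_iff)
      then show ?thesis using kW by (rule card_ge)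
    qed
  qed
  then show ?thesis
    using WV unfolding metric_generator_def metric_generator_for_def D_def
    by (auto simp: pverts_hierarchical_product)
qed

end

theorem theorem2p3:
  fixes G :: "'a pair_pre_digraph" and H :: "'b pair_pre_digraph"
    and u :: 'a and k :: nat and t :: enat
  assumes "k \<ge> 1"
    and "connected_graph G"
    and "connected_graph H"
    and "card (pverts H) \<ge> 2"
    and "u \<in> pverts G"
    and "\<not> rooted_path G u"
    and "rooted_metric_dim k G u = t"
    and "metric_dim (ceil_div k t) H < \<infinity>"
  shows "metric_dim k (hierarchical_product G u H)
           = enat (card (pverts H)) * rooted_metric_dim k G u"
proof (rule antisym)
  note GHu = assms(2,3,5)
  show "enat (card (pverts H)) * rooted_metric_dim k G u
      \<le> metric_dim k (hierarchical_product G u H)"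
    unfolding metric_dim_def
    by (intro INF_greatest) (simp add: metric_generator_card_ge[OF GHu])
  show "metric_dim k (hierarchical_product G u H)
      \<le> enat (card (pverts H)) * rooted_metric_dim k G u"
  proof (cases "\<exists>W. rooted_metric_generator k G u W")
    case False
    then have "rooted_metric_dim k G u = \<infinity>"
      by (simp add: rooted_metric_dim_def top_enat_def)
    \<comment> \<open>In \<open>enat\<close>, zero times infinity is zero, so the right-hand side is
      infinite only because \<open>H\<close> has a vertex.\<close>
    then show ?thesis using assms(4) by (simp add: imult_is_infinity zero_enat_def)
  next
    case True
    \<comment> \<open>\<open>enat\<close> is well-ordered, so the infimum over a nonempty family is
      attained by some \<open>W\<close>.\<close>
    then have "rooted_metric_dim k G u
        \<in> (\<lambda>W. enat (card W)) ` {W. rooted_metric_generator k G u W}"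
      unfolding rooted_metric_dim_def by (meson Inf_enat_def LeastI ex_in_conv image_eqI
          mem_Collect_eq wellorder_InfI)
    then obtain W where W: "rooted_metric_generator k G u W"
      and t: "rooted_metric_dim k G u = enat (card W)" by auto
    have "metric_generator k (hierarchical_product G u H) (W \<times> pverts H)"
      using metric_generator_Times[OF GHu W] rooted_metric_generator_card_ge[OF assms(2,5,6) W]
        assms(4) by blast
    then have "metric_dim k (hierarchical_product G u H) \<le> enat (card (W \<times> pverts H))"
      unfolding metric_dim_def by (intro INF_lower) simp
    also have "\<dots> = enat (card (pverts H)) * rooted_metric_dim k G u"
      by (simp add: t card_cartesian_product)
    finally show ?thesis .
  qed
qed

end
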